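(* Let $\mathcal{A}$ be a real central hyperplane arrangement that is bineighborly with respect to a fundamental chamber $c_0$. Then for all chambers $x,y\in\mathcal{P}(\mathcal{A},c_0)$, the separation set $S(x\vee y)$ equals the 2-closure of $S(x)\cup S(y)$.
   Context: $\mathcal{A}$ is a finite set of linear hyperplanes in $\mathbb{R}^n$; chambers are the connected components of the complement of their union. $S(c,c')$ is the set of hyperplanes separating chambers $c,c'$ and $S(c)=S(c_0,c)$; $\mathcal{P}(\mathcal{A},c_0)$ orders chambers by $c\le c'$ iff $S(c)\subseteq S(c')$. The walls $\mathcal{W}(c)$ of $c$ are the hyperplanes $H$ with $\dim(\overline{c}\cap H)=n-1$. A chamber $c$ is incident to an intersection subspace $X$ if $\overline{c}\cap X$ spans $X$. $(\mathcal{A},c_0)$ is bineighborly if for every chamber $c$ and all $H,H'\in\mathcal{W}(c)\cap S(c)$, $c$ is incident to $H\cap H'$. For bineighborly arrangements $\mathcal{P}(\mathcal{A},c_0)$ is a lattice, with join $\vee$. A set $I\subseteq\mathcal{A}$ is convex (w.r.t. $c_0$) if for each $H\in\mathcal{A}\setminus I$ there is a chamber $c$ with $H\in S(c)\subseteq\mathcal{A}\setminus I$; $I$ is 2-closed if for every codimension 2 intersection subspace $X$, $I\cap\mathcal{A}_X$ is convex in $\mathcal{A}_X=\{H:H\supseteq X\}$ with fundamental chamber the chamber of $\mathcal{A}_X$ containing $c_0$. The 2-closure of a set is the smallest 2-closed set containing it. *)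

theory Defs
  imports "HOL-Analysis.Analysis" "HOL-Algebra.Lattice"
begin

definition central_arrangement :: "'a::euclidean_space set set \<Rightarrow> bool" where
  "central_arrangement \<A> \<longleftrightarrow>
     finite \<A> \<and> (\<forall>H\<in>\<A>. subspace H \<and> dim H = DIM('a) - 1)"

definition chambers :: "'a::euclidean_space set set \<Rightarrow> 'a set set" where
  "chambers \<A> = components (- \<Union>\<A>)"

definition separates :: "'a::euclidean_space set \<Rightarrow> 'a set \<Rightarrow> 'a set \<Rightarrow> bool" where
  "separates H c c' \<longleftrightarrow>
     (\<exists>a. a \<noteq> 0 \<and> H = {x. a \<bullet> x = 0} \<and> (\<forall>x\<in>c. a \<bullet> x < 0) \<and> (\<forall>x\<in>c'. a \<bullet> x > 0))"

definition sep_set :: "'a::euclidean_space set set \<Rightarrow> 'a set \<Rightarrow> 'a set \<Rightarrow> 'a set set" where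
  "sep_set \<A> c c' = {H \<in> \<A>. separates H c c'}"

text \<open>Given as an order record so that joins are those of \<open>HOL-Algebra.Lattice\<close>.\<close>

definition region_poset :: "'a::euclidean_space set set \<Rightarrow> 'a set \<Rightarrow> 'a set gorder" where
  "region_poset \<A> c\<^sub>0 =
     \<lparr>carrier = chambers \<A>, eq = (=), le = (\<lambda>c c'. sep_set \<A> c\<^sub>0 c \<subseteq> sep_set \<A> c\<^sub>0 c')\<rparr>"

definition walls :: "'a::euclidean_space set set \<Rightarrow> 'a set \<Rightarrow> 'a set set" where
  "walls \<A> c = {H \<in> \<A>. aff_dim (closure c \<inter> H) = int DIM('a) - 1}"

definition incident :: "'a::euclidean_space set \<Rightarrow> 'a set \<Rightarrow> bool" where
  "incident c X \<longleftrightarrow> span (closure c \<inter> X) = X"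

definition bineighborly :: "'a::euclidean_space set set \<Rightarrow> 'a set \<Rightarrow> bool" where
  "bineighborly \<A> c\<^sub>0 \<longleftrightarrow>
     (\<forall>c\<in>chambers \<A>. \<forall>H\<in>walls \<A> c \<inter> sep_set \<A> c\<^sub>0 c. \<forall>H'\<in>walls \<A> c \<inter> sep_set \<A> c\<^sub>0 c.
        incident c (H \<inter> H'))"

definition convex_wrt :: "'a::euclidean_space set set \<Rightarrow> 'a set \<Rightarrow> 'a set set \<Rightarrow> bool" where
  "convex_wrt \<A> c\<^sub>0 I \<longleftrightarrow> I \<subseteq> \<A> \<and>
     (\<forall>H\<in>\<A> - I. \<exists>c\<in>chambers \<A>. H \<in> sep_set \<A> c\<^sub>0 c \<and> sep_set \<A> c\<^sub>0 c \<subseteq> \<A> - I)"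

definition intersection_subspaces :: "'a::euclidean_space set set \<Rightarrow> 'a set set" where
  "intersection_subspaces \<A> = {\<Inter>\<B> | \<B>. \<B> \<subseteq> \<A>}"

definition localization :: "'a::euclidean_space set set \<Rightarrow> 'a set \<Rightarrow> 'a set set" where
  "localization \<A> X = {H \<in> \<A>. X \<subseteq> H}"

definition chamber_containing :: "'a::euclidean_space set set \<Rightarrow> 'a set \<Rightarrow> 'a set" where
  "chamber_containing \<B> c = (THE d. d \<in> chambers \<B> \<and> c \<subseteq> d)"

definition two_closed :: "'a::euclidean_space set set \<Rightarrow> 'a set \<Rightarrow> 'a set set \<Rightarrow> bool" where
  "two_closed \<A> c\<^sub>0 I \<longleftrightarrow> I \<subseteq> \<A> \<and>
     (\<forall>X\<in>intersection_subspaces \<A>. dim X + 2 = DIM('a) \<longrightarrow>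
        convex_wrt (localization \<A> X) (chamber_containing (localization \<A> X) c\<^sub>0)
          (I \<inter> localization \<A> X))"

definition two_closure :: "'a::euclidean_space set set \<Rightarrow> 'a set \<Rightarrow> 'a set set \<Rightarrow> 'a set set" where
  "two_closure \<A> c\<^sub>0 K = two_closed \<A> c\<^sub>0 hull K"

text \<open>The description in \<open>chamber_containing\<close> is well defined, and the hull in \<open>two_closure\<close> is
  itself 2-closed, hence the smallest 2-closed set containing the given one.\<close>

lemma chamber_containing_unique:
  assumes "c \<in> chambers \<A>" and "\<B> \<subseteq> \<A>"
  shows "\<exists>!d. d \<in> chambers \<B> \<and> c \<subseteq> d"
proof -
  have c: "connected c" "c \<noteq> {}" "c \<subseteq> - \<Union>\<A>"
    using assms(1) by (auto simp: chambers_def in_components_connected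
        in_components_nonempty dest: in_components_subset)
  then have "c \<subseteq> - \<Union>\<B>" "- \<Union>\<B> \<noteq> {}" using assms(2) by blast+
  then obtain d where d: "d \<in> components (- \<Union>\<B>)" "c \<subseteq> d"
    using exists_component_superset c(1) by metis
  moreover have "d' = d" if "d' \<in> components (- \<Union>\<B>)" "c \<subseteq> d'" for d'
    using components_eq[OF d(1) that(1)] d(2) that(2) c(2) by blast
  ultimately show ?thesis unfolding chambers_def by blast
qed

lemma two_closed_two_closure:
  fixes \<A> :: "'a::euclidean_space set set"
  assumes "K \<subseteq> \<A>"
  shows "two_closed \<A> c\<^sub>0 (two_closure \<A> c\<^sub>0 K)"
proof -
  let ?F = "{J. two_closed \<A> c\<^sub>0 J \<and> K \<subseteq> J}"
  have "\<A> \<in> ?F"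
    using assms by (auto simp: two_closed_def convex_wrt_def localization_def)
  then have sub: "\<Inter>?F \<subseteq> \<A>" by blast
  have "two_closed \<A> c\<^sub>0 (\<Inter>?F)"
  proof (subst two_closed_def, intro conjI ballI impI)
    show "\<Inter>?F \<subseteq> \<A>" by (fact sub)
  next
    fix X assume X: "X \<in> intersection_subspaces \<A>" "dim X + 2 = DIM('a)"
    let ?B = "localization \<A> X" and ?d = "chamber_containing (localization \<A> X) c\<^sub>0"
    show "convex_wrt ?B ?d (\<Inter>?F \<inter> ?B)"
      unfolding convex_wrt_def
    proof (intro conjI ballI)
      fix H assume H: "H \<in> ?B - \<Inter>?F \<inter> ?B"
      then obtain J where J: "J \<in> ?F" "H \<notin> J" by blast
      then have "convex_wrt ?B ?d (J \<inter> ?B)"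
        using X by (auto simp: two_closed_def)
      then obtain c where "c \<in> chambers ?B" "H \<in> sep_set ?B ?d c"
          "sep_set ?B ?d c \<subseteq> ?B - J \<inter> ?B"
        using H J(2) unfolding convex_wrt_def by blast
      then show "\<exists>c\<in>chambers ?B. H \<in> sep_set ?B ?d c \<and>
          sep_set ?B ?d c \<subseteq> ?B - \<Inter>?F \<inter> ?B"
        using J(1) by blast
    qed (simp_all)
  qed
  then show ?thesis by (simp add: two_closure_def hull_def)
qed

end

theory Submission
  imports Defs
begin

text \<open>It suffices to find a chamber \<open>z\<close> whose separation set is the 2-closure of \<open>S(x) \<union> S(y)\<close>:
  separation sets are 2-closed, so such a \<open>z\<close> is below every common upper bound of \<open>x\<close> and \<open>y\<close>.
  As in the Bjorner-Edelman-Ziegler criterion for lattices, the existence of \<open>z\<close> reduces, by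
  downward induction on a common lower bound, to the case where \<open>x\<close> and \<open>y\<close> cover a common
  chamber \<open>c\<close>, crossing walls \<open>H\<close> and \<open>H'\<close> of \<open>c\<close>. Bineighborliness, applied to \<open>- c\<close>,
  makes \<open>c\<close> incident to \<open>X = H \<inter> H'\<close>; the chamber opposite to \<open>c\<close> across \<open>X\<close> is then \<open>z\<close>. Every
  normal of a hyperplane through \<open>X\<close> is a nonnegative combination of those of \<open>H\<close> and \<open>H'\<close>, so
  a 2-closed set containing \<open>H\<close> and \<open>H'\<close> contains all hyperplanes through \<open>X\<close>.\<close>

section \<open>Hulls and least upper bounds\<close>

text \<open>The induction is over \<open>C\<close>: with \<open>insert H C \<subseteq> X\<close>, \<open>insert H' C \<subseteq> Y\<close> and \<open>D\<close> the
  closure of the two steps, first close \<open>X \<union> D\<close> above \<open>insert H C\<close> to \<open>W\<close>, then \<open>W \<union> Y\<close>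
  above \<open>insert H' C\<close>.\<close>

lemma closed_hull_of_Un_mem:
  fixes T :: "'b set set"
  assumes fin: "finite A" and TA: "\<And>C. C \<in> T \<Longrightarrow> C \<subseteq> A"
    and PT: "\<And>C. C \<in> T \<Longrightarrow> P C"
    and step: "\<And>C X. \<lbrakk>C \<in> T; X \<in> T; C \<subset> X\<rbrakk> \<Longrightarrow> \<exists>H. H \<in> X \<and> H \<notin> C \<and> U C H \<and> insert H C \<in> T"
    and diamond: "\<And>C H H'. \<lbrakk>C \<in> T; U C H; U C H'\<rbrakk> \<Longrightarrow> P hull insert H (insert H' C) \<in> T"
    and hull: "\<And>K. K \<subseteq> A \<Longrightarrow> P (P hull K)"
    and "C \<in> T" "X \<in> T" "Y \<in> T" "C \<subseteq> X" "C \<subseteq> Y"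
  shows "P hull (X \<union> Y) \<in> T"
  using assms(7-)
proof (induction "card (A - C)" arbitrary: C X Y rule: less_induct)
  case less
  have closed: "P hull Z = Z" if "Z \<in> T" for Z
    using PT[OF that] by (intro hull_unique) auto
  have XA: "X \<subseteq> A" "Y \<subseteq> A" "C \<subseteq> A" using TA less.prems by auto
  show ?case
  proof (cases "C = X \<or> C = Y")
    case True
    then have "X \<union> Y = X \<or> X \<union> Y = Y" using less.prems by auto
    then show ?thesis using closed less.prems by metis
  next
    case False
    obtain H where H: "H \<in> X" "H \<notin> C" "U C H" "insert H C \<in> T"
      using step[of C X] less.prems False by blast
    obtain H' where H': "H' \<in> Y" "H' \<notin> C" "U C H'" "insert H' C \<in> T"
      using step[of C Y] less.prems False by blast
    define D where "D = P hull insert H (insert H' C)"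
    have D: "D \<in> T" "insert H (insert H' C) \<subseteq> D"
      unfolding D_def using diamond less.prems H H' by (auto simp: hull_inc)
    have card: "card (A - insert h C) < card (A - C)" if "h \<in> A" "h \<notin> C" for h
      using that fin by (intro psubset_card_mono) auto
    define W where "W = P hull (X \<union> D)"
    have W: "W \<in> T" unfolding W_def
      using less.hyps[OF card[of H] H(4), of X D] H XA D less.prems by auto
    have XDW: "X \<union> D \<subseteq> W" unfolding W_def by (rule hull_subset)
    have "H' \<in> A" "insert H' C \<subseteq> W" "insert H' C \<subseteq> Y"
      using H' XA D XDW less.prems by blast+
    then have Z: "P hull (W \<union> Y) \<in> T"
      using less.hyps[OF card H'(4)] H'(2) W less.prems by blast
    \<comment> \<open>The detour through \<open>D\<close> adds nothing: \<open>H\<close>,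
      \<open>H'\<close> and \<open>C\<close> already lie in \<open>X \<union> Y\<close>, so
      \<open>D\<close> and then \<open>W\<close> lie in its hull.\<close>
    have "P hull (W \<union> Y) = P hull (X \<union> Y)"
    proof
      have PJ: "P (P hull (X \<union> Y))" using hull XA by auto
      have XY: "X \<union> Y \<subseteq> P hull (X \<union> Y)" by (rule hull_subset)
      have "D \<subseteq> P hull (X \<union> Y)" unfolding D_def
        by (rule hull_minimal[where S = P, OF _ PJ]) (use XY H H' less.prems in blast)
      then have "W \<subseteq> P hull (X \<union> Y)" unfolding W_def
        by (intro hull_minimal[where S = P, OF _ PJ]) (use XY in blast)
      then show "P hull (W \<union> Y) \<subseteq> P hull (X \<union> Y)"
        by (intro hull_minimal[where S = P, OF _ PJ]) (use XY in blast)
      show "P hull (X \<union> Y) \<subseteq> P hull (W \<union> Y)"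
        using XDW by (intro hull_mono) auto
    qed
    with Z show ?thesis by simp
  qed
qed

lemma two_closure_minimal:
  assumes "K \<subseteq> J" "two_closed \<A> c\<^sub>0 J"
  shows "two_closure \<A> c\<^sub>0 K \<subseteq> J"
  unfolding two_closure_def using assms by (rule hull_minimal)

text \<open>Only uniqueness of the separation set of a least upper bound is needed, so the
  antisymmetry of the order on chambers plays no role.\<close>

lemma sep_set_join:
  assumes "z \<in> chambers \<A>" "x \<in> chambers \<A>" "y \<in> chambers \<A>"
    and "\<And>w. w \<in> chambers \<A> \<Longrightarrow> sep_set \<A> c\<^sub>0 z \<subseteq> sep_set \<A> c\<^sub>0 w \<longleftrightarrow>
          sep_set \<A> c\<^sub>0 x \<subseteq> sep_set \<A> c\<^sub>0 w \<and> sep_set \<A> c\<^sub>0 y \<subseteq> sep_set \<A> c\<^sub>0 w"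
  shows "sep_set \<A> c\<^sub>0 (x \<squnion>\<^bsub>region_poset \<A> c\<^sub>0\<^esub> y) = sep_set \<A> c\<^sub>0 z"
proof -
  let ?L = "region_poset \<A> c\<^sub>0"
  have U: "Upper ?L {x, y} = {w \<in> chambers \<A>. sep_set \<A> c\<^sub>0 z \<subseteq> sep_set \<A> c\<^sub>0 w}"
    using assms by (auto simp: Upper_def region_poset_def)
  have z: "least ?L z (Upper ?L {x, y})"
    unfolding U least_def using assms(1) by (auto simp: region_poset_def)
  \<comment> \<open>The join is a \<open>SOME\<close> choice; that it is a least upper bound follows
    from \<open>z\<close> being one.\<close>
  have "least ?L (x \<squnion>\<^bsub>?L\<^esub> y) (Upper ?L {x, y})"
    unfolding join_def sup_def using z by (rule someI)
  with z show ?thesis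
    unfolding U least_def by (auto simp: region_poset_def)
qed

section \<open>Linear algebra of hyperplanes\<close>

lemma hyperplane_eq_inner:
  assumes "subspace H" "dim H = DIM('a) - 1"
  obtains a where "a \<noteq> 0" "H = {x::'a::euclidean_space. a \<bullet> x = 0}"
proof -
  \<comment> \<open>\<open>DIM('a) - 1\<close> is truncated subtraction, so strictness needs a
    positive dimension.\<close>
  have "dim H < DIM('a)" using assms(2) DIM_positive[where 'a='a] by simp
  then obtain a where a: "a \<noteq> 0" "span H \<subseteq> {x. a \<bullet> x = 0}"
    using lowdim_subset_hyperplane by blast
  have "H = {x. a \<bullet> x = 0}"
  proof (rule subspace_dim_equal)
    show "H \<subseteq> {x. a \<bullet> x = 0}" using a(2) span_superset by blast
    show "dim {x. a \<bullet> x = 0} \<le> dim H"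
      using assms(2) a(1) by (simp add: dim_hyperplane)
  qed (use assms subspace_hyperplane in auto)
  with a(1) that show thesis by blast
qed

text \<open>In finite dimension a subspace is its own double orthogonal complement; here the
  subspace is \<open>span {a, b}\<close>.\<close>

lemma orthogonal_to_pair_imp_combination:
  fixes a b k :: "'a::euclidean_space"
  assumes "\<And>x. a \<bullet> x = 0 \<Longrightarrow> b \<bullet> x = 0 \<Longrightarrow> k \<bullet> x = 0"
  obtains s t where "k = s *\<^sub>R a + t *\<^sub>R b"
proof -
  have "k \<in> (span {a, b})\<^sup>\<bottom>\<^sup>\<bottom>"
    using assms unfolding orthogonal_comp_def orthogonal_def
    by (auto simp: span_base inner_commute)
  then have "k \<in> span {a, b}" by (simp add: orthogonal_comp_self)
  then obtain s t where "k - s *\<^sub>R a = t *\<^sub>R b"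
    unfolding span_breakdown_eq span_singleton by blast
  then have "k = s *\<^sub>R a + t *\<^sub>R b" by (simp add: algebra_simps)
  then show thesis by (rule that)
qed

text \<open>For \<open>a = b\<close> the set \<open>{a, b}\<close> is a singleton that may still be
  independent, hence the separate assumption \<open>a \<noteq> b\<close>.\<close>

lemma dim_orthogonal_to_pair:
  fixes a b :: "'a::euclidean_space"
  assumes "independent {a, b}" "a \<noteq> b"
  shows "dim {x. a \<bullet> x = 0 \<and> b \<bullet> x = 0} + 2 = DIM('a)"
proof -
  have eq: "{y \<in> UNIV. \<forall>x \<in> span {a, b}. orthogonal x y} = {x. a \<bullet> x = 0 \<and> b \<bullet> x = 0}"
  proof (intro Collect_cong iffI)
    fix y assume "y \<in> UNIV \<and> (\<forall>x\<in>span {a, b}. orthogonal x y)"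
    then show "a \<bullet> y = 0 \<and> b \<bullet> y = 0" by (auto simp: orthogonal_def span_base)
  next
    fix y assume "a \<bullet> y = 0 \<and> b \<bullet> y = 0"
    then have "orthogonal y x" if "x \<in> span {a, b}" for x
      using that by (intro orthogonal_to_span[OF that]) (auto simp: orthogonal_def inner_commute)
    then show "y \<in> UNIV \<and> (\<forall>x\<in>span {a, b}. orthogonal x y)"
      by (simp add: orthogonal_commute)
  qed
  have "dim {x. a \<bullet> x = 0 \<and> b \<bullet> x = 0} + dim (span {a, b}) = dim (UNIV :: 'a set)"
    using dim_subspace_orthogonal_to_vectors[OF subspace_span subspace_UNIV, of "{a, b}"] eq by simp
  moreover have "dim {a, b} = 2"
    using dim_eq_card_independent[OF assms(1)] assms(2) by simp
  ultimately show ?thesis by simp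
qed

text \<open>By continuity each nonzero sign survives for small \<open>e\<close>, and finiteness of
  \<open>I\<close> gives one \<open>e\<close> for all. This allows leaving a wall or an intersection
  subspace into a chamber without crossing other hyperplanes.\<close>

lemma small_perturbation_preserves_signs:
  fixes f :: "'i \<Rightarrow> 'a::euclidean_space" and r v :: 'a
  assumes "finite I"
  obtains e :: real where "e > 0"
    "\<And>i. i \<in> I \<Longrightarrow> f i \<bullet> r \<noteq> 0 \<Longrightarrow> (f i \<bullet> (r + e *\<^sub>R v)) * (f i \<bullet> r) > 0"
proof -
  have "\<forall>\<^sub>F e in at_right 0. f i \<bullet> r \<noteq> 0 \<longrightarrow> (f i \<bullet> (r + e *\<^sub>R v)) * (f i \<bullet> r) > 0" for i
  proof (cases "f i \<bullet> r = 0")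
    case False
    have "((\<lambda>e. (f i \<bullet> (r + e *\<^sub>R v)) * (f i \<bullet> r)) \<longlongrightarrow> (f i \<bullet> (r + 0 *\<^sub>R v)) * (f i \<bullet> r)) (at_right 0)"
      by (intro tendsto_intros)
    moreover have "(f i \<bullet> (r + 0 *\<^sub>R v)) * (f i \<bullet> r) > 0"
      using False by (auto simp: zero_less_mult_iff linorder_neq_iff)
    ultimately have "\<forall>\<^sub>F e in at_right 0. (f i \<bullet> (r + e *\<^sub>R v)) * (f i \<bullet> r) > 0"
      by (rule order_tendstoD(1))
    then show ?thesis by (rule eventually_mono) simp
  qed simp
  then have "\<forall>\<^sub>F e in at_right 0. \<forall>i\<in>I. f i \<bullet> r \<noteq> 0 \<longrightarrow> (f i \<bullet> (r + e *\<^sub>R v)) * (f i \<bullet> r) > 0"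
    using assms by (auto intro: eventually_ball_finite)
  moreover have "\<forall>\<^sub>F e::real in at_right 0. 0 < e" by (rule eventually_at_right_less)
  ultimately have "\<forall>\<^sub>F e in at_right 0. 0 < e \<and>
      (\<forall>i\<in>I. f i \<bullet> r \<noteq> 0 \<longrightarrow> (f i \<bullet> (r + e *\<^sub>R v)) * (f i \<bullet> r) > 0)"
    by (rule eventually_elim2) auto
  then obtain e where "0 < e \<and>
      (\<forall>i\<in>I. f i \<bullet> r \<noteq> 0 \<longrightarrow> (f i \<bullet> (r + e *\<^sub>R v)) * (f i \<bullet> r) > 0)"
    using eventually_happens'[OF trivial_limit_at_right_real] by blast
  then show thesis using that by blast
qed

lemma independent_pair_coeffs:
  fixes u v :: "'a::real_vector"
  assumes "independent {u, v}" "u \<noteq> v" "s *\<^sub>R u = t *\<^sub>R v"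
  shows "s = 0"
proof (rule ccontr)
  assume "s \<noteq> 0"
  then have "u = (t / s) *\<^sub>R v" using assms(3)
    by (metis divide_inverse_commute real_vector.scale_scale scaleR_one left_inverse)
  then have "u \<in> span {v}" by (simp add: span_base span_mul)
  then show False using assms by (simp add: independent_insert)
qed

section \<open>Chambers and separation sets as sign patterns\<close>

text \<open>Normals are oriented so that the base point \<open>b\<close> is on the negative side of
  every hyperplane. Being separated from the chamber of \<open>b\<close> then becomes positivity of
  a linear form.\<close>

locale based_arrangement =
  fixes \<A> :: "'a::euclidean_space set set" and \<nu> :: "'a set \<Rightarrow> 'a" and b :: 'a
  assumes fin: "finite \<A>"
    and nz: "H \<in> \<A> \<Longrightarrow> \<nu> H \<noteq> 0"
    and hyp: "H \<in> \<A> \<Longrightarrow> H = {x. \<nu> H \<bullet> x = 0}"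
    and neg: "H \<in> \<A> \<Longrightarrow> \<nu> H \<bullet> b < 0"
begin

definition generic :: "'a \<Rightarrow> bool" where
  "generic p \<longleftrightarrow> (\<forall>H\<in>\<A>. \<nu> H \<bullet> p \<noteq> 0)"

definition pos :: "'a \<Rightarrow> 'a set set" where
  "pos p = {H \<in> \<A>. \<nu> H \<bullet> p > 0}"

text \<open>The products express equality of signs without a case split. If \<open>p\<close> lies on
  some hyperplane, the set is empty.\<close>

definition cham :: "'a \<Rightarrow> 'a set" where
  "cham p = {x. \<forall>H\<in>\<A>. (\<nu> H \<bullet> x) * (\<nu> H \<bullet> p) > 0}"

lemma subarrangement: "\<B> \<subseteq> \<A> \<Longrightarrow> based_arrangement \<B> \<nu> b"
  using fin nz hyp neg by unfold_locales (auto intro: finite_subset)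

lemma hyperplane_eq: "H \<in> \<A> \<Longrightarrow> {x. \<nu> H \<bullet> x = 0} = H"
  using hyp by blast

lemma mem_iff: "H \<in> \<A> \<Longrightarrow> x \<in> H \<longleftrightarrow> \<nu> H \<bullet> x = 0"
  using hyp by blast

lemma generic_iff: "generic p \<longleftrightarrow> p \<notin> \<Union>\<A>"
  unfolding generic_def using mem_iff by blast

lemma generic_base: "generic b"
  unfolding generic_def using neg by fastforce

lemma generic_uminus: "generic (- p) \<longleftrightarrow> generic p"
  unfolding generic_def by simp

lemma pos_uminus: "generic p \<Longrightarrow> pos (- p) = \<A> - pos p"
  unfolding generic_def pos_def by force

lemma mem_cham: "generic p \<Longrightarrow> p \<in> cham p"
  unfolding generic_def cham_def by (auto simp: zero_less_mult_iff)

lemma open_cham: "open (cham p)"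
proof -
  have "cham p = (\<Inter>H\<in>\<A>. {x. (\<nu> H \<bullet> x) * (\<nu> H \<bullet> p) > 0})"
    by (auto simp: cham_def)
  moreover have "open {x. (\<nu> H \<bullet> x) * (\<nu> H \<bullet> p) > 0}" for H
    by (intro open_Collect_less continuous_intros)
  ultimately show ?thesis using fin by auto
qed

text \<open>An intersection of half-spaces is convex, hence connected. It is maximal because a
  connected set reaching a point of another sign pattern meets a hyperplane, by the intermediate
  value theorem.\<close>

lemma cham_in_chambers:
  assumes "generic p"
  shows "cham p \<in> chambers \<A>"
proof -
  have conv: "convex (cham p)"
  proof -
    have "cham p = (\<Inter>H\<in>\<A>. {x. ((\<nu> H \<bullet> p) *\<^sub>R \<nu> H) \<bullet> x > 0})"
      by (auto simp: cham_def mult.commute)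
    then show ?thesis by (simp only:) (intro convex_INT convex_halfspace_gt)
  qed
  have "cham p \<in> components (- \<Union>\<A>)"
    unfolding in_components_maximal
  proof (intro conjI allI impI)
    show "cham p \<noteq> {}" using mem_cham[OF assms] by blast
    show "cham p \<subseteq> - \<Union>\<A>" using mem_iff by (fastforce simp: cham_def)
    show "connected (cham p)" using conv by (rule convex_connected)
  next
    fix d assume d: "d \<noteq> {} \<and> cham p \<subseteq> d \<and> d \<subseteq> - \<Union> \<A> \<and> connected d"
    then have p: "p \<in> d" using mem_cham[OF assms] by blast
    have "x \<in> cham p" if x: "x \<in> d" for x
    proof (rule ccontr)
      assume "x \<notin> cham p"
      then obtain H where H: "H \<in> \<A>" "(\<nu> H \<bullet> x) * (\<nu> H \<bullet> p) \<le> 0" by (auto simp: cham_def)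
      have "\<exists>z\<in>d. \<nu> H \<bullet> z = 0"
      proof (cases "\<nu> H \<bullet> x \<le> 0")
        case True
        show ?thesis
        proof (cases "\<nu> H \<bullet> p \<ge> 0")
          case True
          then show ?thesis using connected_ivt_hyperplane[of d x p "\<nu> H" 0] d x p \<open>\<nu> H \<bullet> x \<le> 0\<close> by auto
        next
          case False
          then have "\<nu> H \<bullet> x = 0" using H True by (auto simp: mult_le_0_iff)
          then show ?thesis using x by auto
        qed
      next
        case False
        then have "\<nu> H \<bullet> p \<le> 0" using H by (auto simp: mult_le_0_iff)
        then show ?thesis using connected_ivt_hyperplane[of d p x "\<nu> H" 0] d x p False by auto
      qed
      then show False using d mem_iff[OF H(1)] H(1) by blast
    qed
    then show "d = cham p" using d by blast
  qed
  then show ?thesis by (simp add: chambers_def)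
qed

lemma chamber_eq_cham:
  assumes "c \<in> chambers \<A>" "p \<in> c"
  shows "generic p" "c = cham p"
proof -
  have "c \<subseteq> - \<Union>\<A>" using assms(1) unfolding chambers_def by (rule in_components_subset)
  then show g: "generic p" using assms(2) by (auto simp: generic_iff)
  show "c = cham p"
    using components_eq[of c "- \<Union>\<A>" "cham p"] assms cham_in_chambers[OF g] mem_cham[OF g]
    unfolding chambers_def by blast
qed

lemma chamber_obtain:
  assumes "c \<in> chambers \<A>"
  obtains p where "p \<in> c" "generic p"
proof -
  have "c \<noteq> {}" using assms unfolding chambers_def by (rule in_components_nonempty)
  then obtain p where "p \<in> c" by blast
  then show thesis using that chamber_eq_cham[OF assms] by blast
qed

lemma sep_set_eq_pos:
  assumes "c\<^sub>0 \<in> chambers \<A>" "b \<in> c\<^sub>0" "c \<in> chambers \<A>" "p \<in> c"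
  shows "sep_set \<A> c\<^sub>0 c = pos p"
proof -
  have c0: "c\<^sub>0 = cham b" and c: "c = cham p" and g: "generic p"
    using chamber_eq_cham assms by auto
  have "separates H c\<^sub>0 c \<longleftrightarrow> \<nu> H \<bullet> p > 0" if H: "H \<in> \<A>" for H
  proof
    assume "\<nu> H \<bullet> p > 0"
    then show "separates H c\<^sub>0 c"
      unfolding separates_def using nz[OF H] hyperplane_eq[OF H] neg[OF H] H
      by (intro exI[of _ "\<nu> H"]) (auto simp: c0 c cham_def zero_less_mult_iff)
  next
    assume "separates H c\<^sub>0 c"
    then obtain a where a: "H = {x. a \<bullet> x = 0}" "a \<bullet> b < 0" "a \<bullet> p > 0"
      unfolding separates_def using assms by blast
    \<comment> \<open>\<open>separates\<close> allows any normal \<open>a\<close> of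
      \<open>H\<close>. This \<open>t\<close> puts \<open>b + t *\<^sub>R p\<close> on
      \<open>H\<close>, where \<open>\<nu> H\<close> vanishes as well, so the signs of
      \<open>\<nu> H\<close> at \<open>b\<close> and \<open>p\<close> are opposite.\<close>
    define t where "t = - (a \<bullet> b) / (a \<bullet> p)"
    have t: "t > 0" unfolding t_def using a by (intro divide_pos_pos) auto
    have "a \<bullet> (b + t *\<^sub>R p) = 0" using a by (simp add: t_def inner_diff_right)
    then have "\<nu> H \<bullet> (b + t *\<^sub>R p) = 0" using a(1) mem_iff[OF H] by blast
    then have "t * (\<nu> H \<bullet> p) = - (\<nu> H \<bullet> b)" by (simp add: inner_add_right)
    then have "t * (\<nu> H \<bullet> p) > 0" using neg[OF H] by simp
    then show "\<nu> H \<bullet> p > 0" using t by (simp add: zero_less_mult_iff)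
  qed
  then show ?thesis by (auto simp: sep_set_def pos_def)
qed

lemma sep_sets_eq:
  assumes "c\<^sub>0 \<in> chambers \<A>" "b \<in> c\<^sub>0"
  shows "sep_set \<A> c\<^sub>0 ` chambers \<A> = pos ` Collect generic"
proof (intro equalityI image_subsetI)
  fix c assume c: "c \<in> chambers \<A>"
  then obtain p where "p \<in> c" "generic p" by (rule chamber_obtain)
  then show "sep_set \<A> c\<^sub>0 c \<in> pos ` Collect generic" using sep_set_eq_pos[OF assms c] by auto
next
  fix p assume "p \<in> Collect generic"
  then have "pos p = sep_set \<A> c\<^sub>0 (cham p)" "cham p \<in> chambers \<A>"
    using sep_set_eq_pos[OF assms cham_in_chambers mem_cham] cham_in_chambers by auto
  then show "pos p \<in> sep_set \<A> c\<^sub>0 ` chambers \<A>" by auto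
qed

section \<open>Convex and 2-closed sets in terms of signs\<close>

lemma convex_wrt_iff:
  assumes "c\<^sub>0 \<in> chambers \<A>" "b \<in> c\<^sub>0"
  shows "convex_wrt \<A> c\<^sub>0 I \<longleftrightarrow> I \<subseteq> \<A> \<and>
    (\<forall>H\<in>\<A> - I. \<exists>p. generic p \<and> H \<in> pos p \<and> pos p \<subseteq> \<A> - I)"
proof -
  have "(\<exists>c\<in>chambers \<A>. H \<in> sep_set \<A> c\<^sub>0 c \<and> sep_set \<A> c\<^sub>0 c \<subseteq> \<A> - I) \<longleftrightarrow>
      (\<exists>p. generic p \<and> H \<in> pos p \<and> pos p \<subseteq> \<A> - I)" for H
  proof -
    have "(\<exists>c\<in>chambers \<A>. H \<in> sep_set \<A> c\<^sub>0 c \<and> sep_set \<A> c\<^sub>0 c \<subseteq> \<A> - I) \<longleftrightarrow>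
        (\<exists>S \<in> sep_set \<A> c\<^sub>0 ` chambers \<A>. H \<in> S \<and> S \<subseteq> \<A> - I)" by blast
    also have "\<dots> \<longleftrightarrow> (\<exists>p. generic p \<and> H \<in> pos p \<and> pos p \<subseteq> \<A> - I)"
      unfolding sep_sets_eq[OF assms] by blast
    finally show ?thesis .
  qed
  then show ?thesis by (simp only: convex_wrt_def)
qed

text \<open>The chamber of \<open>\<B>\<close> around \<open>c\<^sub>0\<close> still contains
  \<open>b\<close>, so the same normals and base point serve for every subarrangement.\<close>

lemma convex_wrt_localization_iff:
  assumes "c\<^sub>0 \<in> chambers \<A>" "b \<in> c\<^sub>0" "\<B> \<subseteq> \<A>"
  shows "convex_wrt \<B> (chamber_containing \<B> c\<^sub>0) I \<longleftrightarrow> I \<subseteq> \<B> \<and>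
    (\<forall>H\<in>\<B> - I. \<exists>p. (\<forall>K\<in>\<B>. \<nu> K \<bullet> p \<noteq> 0) \<and> \<nu> H \<bullet> p > 0 \<and> (\<forall>K\<in>I. \<nu> K \<bullet> p \<le> 0))"
proof -
  interpret B: based_arrangement \<B> \<nu> b using assms(3) by (rule subarrangement)
  have "chamber_containing \<B> c\<^sub>0 \<in> chambers \<B>" "b \<in> chamber_containing \<B> c\<^sub>0"
    unfolding chamber_containing_def
    using theI'[OF chamber_containing_unique[OF assms(1,3)]] assms(2) by auto
  note iff = B.convex_wrt_iff[OF this]
  have "B.pos p \<subseteq> \<B> - I \<longleftrightarrow> (\<forall>K\<in>I. \<nu> K \<bullet> p \<le> 0)" if "I \<subseteq> \<B>" for p
    using that unfolding B.pos_def not_less[symmetric] by blast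
  moreover have "H \<in> B.pos p \<longleftrightarrow> \<nu> H \<bullet> p > 0" if "H \<in> \<B>" for H p
    using that by (simp add: B.pos_def)
  ultimately show ?thesis
    unfolding iff B.generic_def by (intro conj_cong ball_cong ex_cong1 refl) auto
qed

text \<open>The antipode \<open>- p\<close> is positive exactly on the hyperplanes outside
  \<open>pos p\<close>, so this one point witnesses convexity in all localizations.\<close>

lemma two_closed_pos:
  assumes "c\<^sub>0 \<in> chambers \<A>" "b \<in> c\<^sub>0" "generic p"
  shows "two_closed \<A> c\<^sub>0 (pos p)"
  unfolding two_closed_def
proof (intro conjI ballI impI)
  show "pos p \<subseteq> \<A>" by (auto simp: pos_def)
  fix X
  have sub: "localization \<A> X \<subseteq> \<A>" by (auto simp: localization_def)
  show "convex_wrt (localization \<A> X) (chamber_containing (localization \<A> X) c\<^sub>0)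
          (pos p \<inter> localization \<A> X)"
    unfolding convex_wrt_localization_iff[OF assms(1,2) sub]
  proof (intro conjI ballI exI[of _ "- p"])
    fix H assume "H \<in> localization \<A> X - pos p \<inter> localization \<A> X"
    then show "\<nu> H \<bullet> - p > 0" using assms(3) sub by (force simp: generic_def pos_def)
  qed (use assms(3) sub in \<open>auto simp: generic_def pos_def\<close>)
qed

text \<open>Proportional nonzero normals define the same hyperplane.\<close>

lemma independent_normals:
  assumes "H \<in> \<A>" "K \<in> \<A>" "H \<noteq> K"
  shows "independent {\<nu> H, \<nu> K}" "\<nu> H \<noteq> \<nu> K"
proof -
  have "\<nu> H \<noteq> t *\<^sub>R \<nu> K" for t
  proof
    assume eq: "\<nu> H = t *\<^sub>R \<nu> K"
    then have "t \<noteq> 0" using nz assms by auto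
    then have "x \<in> H \<longleftrightarrow> x \<in> K" for x
      unfolding mem_iff[OF assms(1)] mem_iff[OF assms(2)] eq by simp
    then have "H = K" by blast
    then show False using assms by simp
  qed
  then have ns: "\<nu> H \<notin> span {\<nu> K}" by (auto simp: span_singleton)
  then show "\<nu> H \<noteq> \<nu> K" by (auto simp: span_base)
  with ns show "independent {\<nu> H, \<nu> K}" using nz[OF assms(2)] by (simp add: independent_insert)
qed

section \<open>Walls and incidence\<close>

text \<open>Such an \<open>r\<close> witnesses that \<open>H\<close> is a wall of \<open>cham p\<close>: it lies in the relative interior of
  the facet of \<open>cham p\<close> in \<open>H\<close>.\<close>

definition wall_pt :: "'a \<Rightarrow> 'a set \<Rightarrow> 'a \<Rightarrow> bool" where
  "wall_pt p H r \<longleftrightarrow> H \<in> \<A> \<and> \<nu> H \<bullet> r = 0 \<and> (\<forall>K\<in>\<A>. K \<noteq> H \<longrightarrow> (\<nu> K \<bullet> r) * (\<nu> K \<bullet> p) > 0)"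

text \<open>Adding \<open>e *\<^sub>R p\<close> with \<open>e > 0\<close> makes every weak
  inequality strict, so \<open>r\<close> is a limit of points of the chamber.\<close>

lemma closure_chamI:
  assumes "\<And>K. K \<in> \<A> \<Longrightarrow> (\<nu> K \<bullet> r) * (\<nu> K \<bullet> p) \<ge> 0" "generic p"
  shows "r \<in> closure (cham p)"
proof -
  have "r + e *\<^sub>R p \<in> cham p" if "e > 0" for e
    unfolding cham_def
  proof (intro CollectI ballI)
    fix K assume K: "K \<in> \<A>"
    have "(\<nu> K \<bullet> (r + e *\<^sub>R p)) * (\<nu> K \<bullet> p) = (\<nu> K \<bullet> r) * (\<nu> K \<bullet> p) + e * (\<nu> K \<bullet> p)\<^sup>2"
      by (simp add: inner_add_right algebra_simps power2_eq_square)
    moreover have "e * (\<nu> K \<bullet> p)\<^sup>2 > 0" using that assms(2) K by (auto simp: generic_def)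
    ultimately show "(\<nu> K \<bullet> (r + e *\<^sub>R p)) * (\<nu> K \<bullet> p) > 0" using assms(1)[OF K] by simp
  qed
  then have "r + e *\<^sub>R p \<in> closure (cham p)" if "e > 0" for e
    using that closure_subset by blast
  then have "\<forall>\<^sub>F e in at_right 0. r + e *\<^sub>R p \<in> closure (cham p)"
    using eventually_at_right_less[of "0::real"] by (rule eventually_mono[rotated])
  moreover have "((\<lambda>e. r + e *\<^sub>R p) \<longlongrightarrow> r + 0 *\<^sub>R p) (at_right 0)"
    by (intro tendsto_intros)
  ultimately have "r + 0 *\<^sub>R p \<in> closure (cham p)"
    by (intro Lim_in_closed_set[OF closed_closure _ trivial_limit_at_right_real])
  then show ?thesis by simp
qed

lemma closure_chamD:
  assumes "r \<in> closure (cham p)" "K \<in> \<A>"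
  shows "(\<nu> K \<bullet> r) * (\<nu> K \<bullet> p) \<ge> 0"
proof -
  have "closed {x. (\<nu> K \<bullet> x) * (\<nu> K \<bullet> p) \<ge> 0}"
    by (intro closed_Collect_le continuous_intros)
  moreover have "cham p \<subseteq> {x. (\<nu> K \<bullet> x) * (\<nu> K \<bullet> p) \<ge> 0}"
    using assms(2) by (auto simp: cham_def less_imp_le)
  ultimately show ?thesis using closure_minimal assms(1) by blast
qed

text \<open>Near \<open>r\<close> the strict inequalities for the other hyperplanes persist, so the
  closed chamber contains a nonempty relatively open part of \<open>H\<close>, which has full
  dimension in \<open>H\<close>.\<close>

lemma wall_pt_imp_walls:
  assumes "wall_pt p H r" "generic p"
  shows "H \<in> walls \<A> (cham p)"
proof -
  have H: "H \<in> \<A>" using assms by (simp add: wall_pt_def)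
  define U where "U = (\<Inter>K\<in>\<A> - {H}. {x. (\<nu> K \<bullet> x) * (\<nu> K \<bullet> p) > 0})"
  have "open {x. (\<nu> K \<bullet> x) * (\<nu> K \<bullet> p) > 0}" for K
    by (intro open_Collect_less continuous_intros)
  then have U: "open U" unfolding U_def using fin by auto
  have r: "r \<in> H \<inter> U" using assms(1) mem_iff[OF H] by (auto simp: wall_pt_def U_def)
  have sub: "H \<inter> U \<subseteq> closure (cham p) \<inter> H"
  proof clarify
    fix x assume x: "x \<in> H" "x \<in> U"
    have "(\<nu> K \<bullet> x) * (\<nu> K \<bullet> p) \<ge> 0" if "K \<in> \<A>" for K
      using that x mem_iff[OF H] by (cases "K = H") (auto simp: U_def less_imp_le)
    then show "x \<in> closure (cham p)" using assms(2) by (rule closure_chamI)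
  qed
  have dimH: "aff_dim H = int DIM('a) - 1"
    using aff_dim_hyperplane[OF nz[OF H], of 0] by (simp add: hyperplane_eq[OF H])
  have "convex H" using convex_hyperplane[of "\<nu> H" 0] by (simp add: hyperplane_eq[OF H])
  then have "aff_dim (H \<inter> U) = aff_dim H" using U r by (intro aff_dim_convex_Int_open) auto
  moreover have "aff_dim (H \<inter> U) \<le> aff_dim (closure (cham p) \<inter> H)"
    using sub by (rule aff_dim_subset)
  moreover have "aff_dim (closure (cham p) \<inter> H) \<le> aff_dim H"
    by (rule aff_dim_subset) auto
  ultimately show ?thesis using dimH H by (simp add: walls_def)
qed

text \<open>If \<open>K\<close> contained all points of the closed chamber in \<open>X\<close>, it
  would contain their span \<open>X\<close>. So each \<open>K\<close> not containing
  \<open>X\<close> misses one of these points. Their sum avoids all such \<open>K\<close> at once,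
  since the values of \<open>\<nu> K\<close> on the closed chamber share a weak sign and cannot
  cancel.\<close>

lemma incident_obtain:
  assumes inc: "incident (cham p) X" and p: "generic p"
  obtains q where "q \<in> X" "\<And>K. K \<in> \<A> \<Longrightarrow> \<not> X \<subseteq> K \<Longrightarrow> (\<nu> K \<bullet> q) * (\<nu> K \<bullet> p) > 0"
proof -
  have sp: "span (closure (cham p) \<inter> X) = X" using inc by (simp add: incident_def)
  define \<B> where "\<B> = {K \<in> \<A>. \<not> X \<subseteq> K}"
  have "\<exists>q \<in> closure (cham p) \<inter> X. \<nu> K \<bullet> q \<noteq> 0" if "K \<in> \<B>" for K
  proof (rule ccontr)
    assume neg: "\<not> ?thesis"
    have K: "K \<in> \<A>" "\<not> X \<subseteq> K" using that by (auto simp: \<B>_def)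
    have "closure (cham p) \<inter> X \<subseteq> K" using neg mem_iff[OF K(1)] by auto
    moreover have "subspace K" using subspace_hyperplane[of "\<nu> K"] by (simp add: hyperplane_eq[OF K(1)])
    ultimately have "span (closure (cham p) \<inter> X) \<subseteq> K" by (rule span_minimal)
    then show False using sp K(2) by simp
  qed
  then obtain f where f: "\<And>K. K \<in> \<B> \<Longrightarrow> f K \<in> closure (cham p) \<inter> X \<and> \<nu> K \<bullet> f K \<noteq> 0"
    by metis
  have finB: "finite \<B>" using fin by (simp add: \<B>_def)
  have "subspace X" using sp subspace_span by metis
  then have 1: "(\<Sum>K\<in>\<B>. f K) \<in> X" using f by (auto intro: subspace_sum)
  have 2: "(\<nu> K \<bullet> (\<Sum>L\<in>\<B>. f L)) * (\<nu> K \<bullet> p) > 0" if "K \<in> \<A>" "\<not> X \<subseteq> K" for K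
  proof -
    have KB: "K \<in> \<B>" using that by (simp add: \<B>_def)
    have ge: "(\<nu> K \<bullet> f L) * (\<nu> K \<bullet> p) \<ge> 0" if "L \<in> \<B>" for L
      using closure_chamD[OF _ \<open>K \<in> \<A>\<close>] f[OF that] by blast
    have "(\<nu> K \<bullet> f K) * (\<nu> K \<bullet> p) \<noteq> 0"
      using f[OF KB] p \<open>K \<in> \<A>\<close> by (simp add: generic_def)
    then have "(\<nu> K \<bullet> f K) * (\<nu> K \<bullet> p) > 0" using ge[OF KB] by linarith
    then have "(\<Sum>L\<in>\<B>. (\<nu> K \<bullet> f L) * (\<nu> K \<bullet> p)) > 0"
      using finB KB ge by (intro sum_pos2) auto
    then show ?thesis by (simp add: inner_sum_right sum_distrib_right)
  qed
  show thesis by (rule that[OF 1 2])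
qed

section \<open>Crossing a single wall\<close>

text \<open>On a segment from \<open>p\<close> to a suitable point in the chamber of
  \<open>q\<close>, only hyperplanes of \<open>pos q - pos p\<close> are crossed. The first of them
  is \<open>H\<close>, and \<open>r\<close> is the crossing point.\<close>

lemma upper_wall_exists:
  assumes p: "generic p" and q: "generic q" and sub: "pos p \<subset> pos q"
  obtains H r p' where "H \<in> pos q" "H \<notin> pos p" "wall_pt p H r"
    "generic p'" "pos p' = insert H (pos p)"
proof -
  \<comment> \<open>\<open>g (H, K) \<bullet> q' = 0\<close> says that the segment from \<open>p\<close> to \<open>q'\<close> meets \<open>H\<close> and \<open>K\<close> at the same
    time; for generic \<open>q'\<close> in the chamber of \<open>q\<close> the hyperplanes are crossed one by one.\<close>
  define g where "g = (\<lambda>(H, K). (\<nu> H \<bullet> p) *\<^sub>R \<nu> K - (\<nu> K \<bullet> p) *\<^sub>R \<nu> H)"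
  define I where "I = {(H, K). H \<in> \<A> \<and> K \<in> \<A> \<and> H \<noteq> K}"
  have "finite I" by (rule finite_subset[of _ "\<A> \<times> \<A>"]) (auto simp: I_def fin)
  have gnz: "g i \<noteq> 0" if i: "i \<in> I" for i
  proof
    assume "g i = 0"
    obtain H K where i: "i = (H, K)" "H \<in> \<A>" "K \<in> \<A>" "H \<noteq> K" using i unfolding I_def by blast
    have "(\<nu> K \<bullet> p) *\<^sub>R \<nu> H = (\<nu> H \<bullet> p) *\<^sub>R \<nu> K" using \<open>g i = 0\<close> by (simp add: g_def i)
    then have "\<nu> K \<bullet> p = 0" using independent_pair_coeffs independent_normals i by metis
    then show False using p i by (simp add: generic_def)
  qed
  \<comment> \<open>A finite union of hyperplanes has measure zero, while the chamber of
    \<open>q\<close> is open and nonempty.\<close>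
  have "negligible (\<Union>i\<in>I. {x. g i \<bullet> x = 0})"
    using \<open>finite I\<close> gnz by (intro negligible_Union) (auto intro!: negligible_hyperplane)
  moreover have "\<not> negligible (cham q)"
    using open_cham mem_cham[OF q] by (intro open_not_negligible) auto
  ultimately obtain q' where q': "q' \<in> cham q" "\<And>i. i \<in> I \<Longrightarrow> g i \<bullet> q' \<noteq> 0"
    using negligible_subset by (metis (mono_tags, lifting) UN_I mem_Collect_eq subsetI)
  have posq: "pos q' = pos q" and gq: "generic q'"
    using q'(1) by (auto simp: pos_def cham_def generic_def zero_less_mult_iff)
  define D where "D = pos q - pos p"
  have D: "finite D" "D \<noteq> {}" using sub fin by (auto simp: D_def pos_def)
  have Dp: "\<nu> H \<bullet> p < 0" "\<nu> H \<bullet> q' > 0" "H \<in> \<A>" if "H \<in> D" for H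
    using that p unfolding D_def posq[symmetric] by (auto simp: pos_def generic_def not_less order_less_le)
  \<comment> \<open>\<open>\<tau> H\<close> is the time at which the segment from \<open>p\<close>
    to \<open>q'\<close> crosses \<open>H\<close>; minimizing it selects the first crossing.\<close>
  define \<tau> where "\<tau> H = (\<nu> H \<bullet> p) / (\<nu> H \<bullet> p - \<nu> H \<bullet> q')" for H
  define H where "H = arg_min_on \<tau> D"
  have H: "H \<in> D" "\<And>K. K \<in> D \<Longrightarrow> \<tau> H \<le> \<tau> K"
    unfolding H_def using D arg_min_if_finite(1)[of D \<tau>] arg_min_least[of D] by auto
  define t where "t = \<tau> H"
  have t: "0 < t" "t < 1" unfolding t_def \<tau>_def using Dp[OF H(1)] by (auto simp: field_simps)
  define r where "r = (1 - t) *\<^sub>R p + t *\<^sub>R q'"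
  have nr: "\<nu> K \<bullet> r = (1 - t) * (\<nu> K \<bullet> p) + t * (\<nu> K \<bullet> q')" for K
    by (simp add: r_def inner_add_right)
  have Hr: "\<nu> H \<bullet> r = 0"
    unfolding nr t_def \<tau>_def using Dp[OF H(1)] by (simp add: field_simps)
  have other: "(\<nu> K \<bullet> r) * (\<nu> K \<bullet> p) > 0" if K: "K \<in> \<A>" "K \<noteq> H" for K
  proof (cases "K \<in> D")
    case True
    have "\<nu> K \<bullet> r \<noteq> 0"
    proof
      assume 0: "\<nu> K \<bullet> r = 0"
      have "g (H, K) \<bullet> q' = (\<nu> H \<bullet> p) * (\<nu> K \<bullet> q') - (\<nu> K \<bullet> p) * (\<nu> H \<bullet> q')"
        by (simp add: g_def inner_diff_left)
      moreover have "t * \<dots> = (\<nu> H \<bullet> p) * (t * (\<nu> K \<bullet> q')) - (\<nu> K \<bullet> p) * (t * (\<nu> H \<bullet> q'))"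
        by (simp add: right_diff_distrib mult.left_commute)
      moreover have "t * (\<nu> K \<bullet> q') = - ((1 - t) * (\<nu> K \<bullet> p))"
          "t * (\<nu> H \<bullet> q') = - ((1 - t) * (\<nu> H \<bullet> p))"
        using 0 Hr unfolding nr by linarith+
      ultimately have "g (H, K) \<bullet> q' = 0" using t by simp
      moreover have "(H, K) \<in> I" using K Dp[OF H(1)] by (auto simp: I_def)
      ultimately show False using q'(2) by blast
    qed
    \<comment> \<open>\<open>K\<close> is crossed no earlier than \<open>H\<close>, so its negative
      value at \<open>p\<close> has at most reached zero at time \<open>t\<close>.\<close>
    moreover have "\<nu> K \<bullet> r \<le> 0"
    proof -
      have "t \<le> (\<nu> K \<bullet> p) / (\<nu> K \<bullet> p - \<nu> K \<bullet> q')" using H(2)[OF True] unfolding t_def \<tau>_def[of K] .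
      then have "t * (\<nu> K \<bullet> p - \<nu> K \<bullet> q') \<ge> \<nu> K \<bullet> p"
        using Dp[OF True] by (simp add: neg_le_divide_eq)
      then show ?thesis unfolding nr by (simp add: algebra_simps)
    qed
    ultimately show ?thesis using Dp[OF True] by (simp add: mult_neg_neg)
  next
    case False
    \<comment> \<open>Outside \<open>D\<close> the signs at \<open>p\<close> and \<open>q'\<close>
      agree, hence stay constant along the segment.\<close>
    then have "K \<in> pos p \<longleftrightarrow> K \<in> pos q'" using sub posq by (auto simp: D_def)
    then have "(\<nu> K \<bullet> p > 0 \<and> \<nu> K \<bullet> q' > 0) \<or> (\<nu> K \<bullet> p < 0 \<and> \<nu> K \<bullet> q' < 0)"
      using p gq K by (auto simp: pos_def generic_def not_less order_less_le)
    then show ?thesis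
    proof
      assume "\<nu> K \<bullet> p > 0 \<and> \<nu> K \<bullet> q' > 0"
      then show ?thesis using t by (auto simp: nr intro!: mult_pos_pos add_pos_pos)
    next
      assume "\<nu> K \<bullet> p < 0 \<and> \<nu> K \<bullet> q' < 0"
      then show ?thesis using t by (auto simp: nr intro!: mult_neg_neg add_neg_neg mult_pos_neg)
    qed
  qed
  obtain e where e: "e > 0" "\<And>K. K \<in> \<A> \<Longrightarrow> \<nu> K \<bullet> r \<noteq> 0 \<Longrightarrow>
      (\<nu> K \<bullet> (r + e *\<^sub>R \<nu> H)) * (\<nu> K \<bullet> r) > 0"
    using small_perturbation_preserves_signs[OF fin, of \<nu> r "\<nu> H"] by metis
  \<comment> \<open>A small move from \<open>r\<close> along the normal of \<open>H\<close> makes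
    the sign of \<open>H\<close> positive and keeps the others.\<close>
  define p' where "p' = r + e *\<^sub>R \<nu> H"
  have Hp': "\<nu> H \<bullet> p' > 0"
    using e(1) Hr nz[OF Dp(3)[OF H(1)]] by (simp add: p'_def inner_add_right)
  have Kp': "(\<nu> K \<bullet> p') * (\<nu> K \<bullet> p) > 0" if "K \<in> \<A>" "K \<noteq> H" for K
    using e(2)[OF that(1)] other[OF that] unfolding p'_def by (auto simp: zero_less_mult_iff)
  show thesis
  proof
    show "H \<in> pos q" "H \<notin> pos p" using H by (auto simp: D_def)
    show "wall_pt p H r" using Hr other Dp[OF H(1)] by (simp add: wall_pt_def)
    show "generic p'" unfolding generic_def
    proof
      fix K assume "K \<in> \<A>"
      then show "\<nu> K \<bullet> p' \<noteq> 0" using Kp'[of K] Hp' by (cases "K = H") auto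
    qed
    show "pos p' = insert H (pos p)"
    proof (rule Set.set_eqI)
      fix K show "K \<in> pos p' \<longleftrightarrow> K \<in> insert H (pos p)"
        using Kp'[of K] Hp' Dp[OF H(1)] by (cases "K = H") (auto simp: pos_def zero_less_mult_iff)
    qed
  qed
qed

section \<open>Two upper walls of a chamber\<close>

text \<open>Bineighborliness is a condition on lower walls; the upper walls of the chamber of \<open>p\<close> are
  the lower walls of the chamber of \<open>- p\<close>.\<close>

lemma upper_walls_incident:
  assumes "c\<^sub>0 \<in> chambers \<A>" "b \<in> c\<^sub>0" "bineighborly \<A> c\<^sub>0"
    and p: "generic p"
    and H: "wall_pt p H r" "H \<notin> pos p" and H': "wall_pt p H' r'" "H' \<notin> pos p"
  obtains q where "q \<in> H \<inter> H'"
    "\<And>K. K \<in> \<A> \<Longrightarrow> \<not> H \<inter> H' \<subseteq> K \<Longrightarrow> (\<nu> K \<bullet> q) * (\<nu> K \<bullet> p) > 0"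
proof -
  have p': "generic (- p)" using p by (simp add: generic_uminus)
  have A: "H \<in> \<A>" "H' \<in> \<A>" using H H' by (auto simp: wall_pt_def)
  have "wall_pt (- p) H (- r)" "wall_pt (- p) H' (- r')" using H H' by (auto simp: wall_pt_def)
  then have w: "H \<in> walls \<A> (cham (- p))" "H' \<in> walls \<A> (cham (- p))"
    using wall_pt_imp_walls p' by auto
  have "sep_set \<A> c\<^sub>0 (cham (- p)) = \<A> - pos p"
    using sep_set_eq_pos[OF assms(1,2) cham_in_chambers mem_cham] p' pos_uminus[OF p] by simp
  then have "incident (cham (- p)) (H \<inter> H')"
    using assms(3) cham_in_chambers[OF p'] w H(2) H'(2) A unfolding bineighborly_def by blast
  then obtain q where q: "q \<in> H \<inter> H'"
      "\<And>K. K \<in> \<A> \<Longrightarrow> \<not> H \<inter> H' \<subseteq> K \<Longrightarrow> (\<nu> K \<bullet> q) * (\<nu> K \<bullet> - p) > 0"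
    using incident_obtain[OF _ p'] by metis
  show thesis
  proof
    \<comment> \<open>The point \<open>q\<close> belongs to the chamber of \<open>- p\<close>; its
      antipode stays in the subspace and belongs to that of \<open>p\<close>.\<close>
    show "- q \<in> H \<inter> H'" using q(1) A mem_iff by simp
    show "(\<nu> K \<bullet> - q) * (\<nu> K \<bullet> p) > 0" if "K \<in> \<A>" "\<not> H \<inter> H' \<subseteq> K" for K
      using q(2)[OF that] by simp
  qed
qed

text \<open>The coefficients are read off by evaluating at the two wall points, and their common sign
  is pinned down by evaluating at \<open>b\<close>.\<close>

lemma upper_walls_combination:
  assumes p: "generic p" and "H \<noteq> H'"
    and H: "wall_pt p H r" "H \<notin> pos p" and H': "wall_pt p H' r'" "H' \<notin> pos p"
    and K: "K \<in> \<A>" "H \<inter> H' \<subseteq> K"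
  shows "K \<notin> pos p" and "\<exists>s t. s \<ge> 0 \<and> t \<ge> 0 \<and> \<nu> K = s *\<^sub>R \<nu> H + t *\<^sub>R \<nu> H'"
proof -
  have A: "H \<in> \<A>" "H' \<in> \<A>" using H H' by (auto simp: wall_pt_def)
  have Hp: "\<nu> H \<bullet> p < 0" "\<nu> H' \<bullet> p < 0"
    using H(2) H'(2) p A by (auto simp: pos_def generic_def not_less order_less_le)
  have "\<nu> K \<bullet> x = 0" if "\<nu> H \<bullet> x = 0" "\<nu> H' \<bullet> x = 0" for x
    using K A that mem_iff by blast
  then obtain s t where st: "\<nu> K = s *\<^sub>R \<nu> H + t *\<^sub>R \<nu> H'"
    by (rule orthogonal_to_pair_imp_combination)
  have ge: "(\<nu> K \<bullet> r) * (\<nu> K \<bullet> p) \<ge> 0" "(\<nu> K \<bullet> r') * (\<nu> K \<bullet> p) \<ge> 0"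
    using H(1) H'(1) K(1) unfolding wall_pt_def
    by (cases "K = H"; cases "K = H'"; force simp: less_imp_le)+
  have "(\<nu> H \<bullet> r') * (\<nu> H \<bullet> p) > 0" "(\<nu> H' \<bullet> r) * (\<nu> H' \<bullet> p) > 0"
    using H(1) H'(1) A \<open>H \<noteq> H'\<close> by (auto simp: wall_pt_def)
  then have r: "\<nu> H \<bullet> r' < 0" "\<nu> H' \<bullet> r < 0"
    using Hp by (auto simp: zero_less_mult_iff)
  have Kr: "\<nu> K \<bullet> r = t * (\<nu> H' \<bullet> r)" "\<nu> K \<bullet> r' = s * (\<nu> H \<bullet> r')"
    using H(1) H'(1) by (auto simp: st inner_add_left wall_pt_def)
  show notpos: "K \<notin> pos p"
  proof
    assume "K \<in> pos p"
    then have "\<nu> K \<bullet> p > 0" by (simp add: pos_def)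
    then have "t \<le> 0" "s \<le> 0"
      using ge r unfolding Kr by (auto simp: zero_le_mult_iff)
    then have "\<nu> K \<bullet> b \<ge> 0"
      using neg[OF A(1)] neg[OF A(2)]
      by (auto simp: st inner_add_left intro!: add_nonneg_nonneg mult_nonpos_nonpos)
    then show False using neg[OF K(1)] by simp
  qed
  then have "\<nu> K \<bullet> p < 0" using p K by (auto simp: pos_def generic_def not_less order_less_le)
  then have "t * (\<nu> H' \<bullet> r) \<le> 0" "s * (\<nu> H \<bullet> r') \<le> 0"
    using ge unfolding Kr by (auto simp: zero_le_mult_iff)
  then have "t \<ge> 0" "s \<ge> 0"
    using r by (auto simp: mult_le_0_iff)
  with st show "\<exists>s t. s \<ge> 0 \<and> t \<ge> 0 \<and> \<nu> K = s *\<^sub>R \<nu> H + t *\<^sub>R \<nu> H'" by blast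
qed

text \<open>Convexity at a missing \<open>K\<close> would give a point positive on \<open>K\<close>
  but nonpositive on \<open>H\<close> and \<open>H'\<close>, although the normal of \<open>K\<close>
  is a nonnegative combination of theirs.\<close>

lemma localization_subset_two_closed:
  assumes "c\<^sub>0 \<in> chambers \<A>" "b \<in> c\<^sub>0"
    and p: "generic p" and "H \<noteq> H'"
    and H: "wall_pt p H r" "H \<notin> pos p" and H': "wall_pt p H' r'" "H' \<notin> pos p"
    and J: "two_closed \<A> c\<^sub>0 J" "H \<in> J" "H' \<in> J"
  shows "localization \<A> (H \<inter> H') \<subseteq> J"
proof (rule ccontr)
  let ?X = "H \<inter> H'" and ?B = "localization \<A> (H \<inter> H')"
  assume "\<not> ?B \<subseteq> J"
  then obtain K where K: "K \<in> ?B" "K \<notin> J" by blast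
  have A: "H \<in> \<A>" "H' \<in> \<A>" using H H' by (auto simp: wall_pt_def)
  have sub: "?B \<subseteq> \<A>" "H \<in> ?B" "H' \<in> ?B" using A by (auto simp: localization_def)
  have "?X = {x. \<nu> H \<bullet> x = 0 \<and> \<nu> H' \<bullet> x = 0}" using A mem_iff by blast
  then have "dim ?X + 2 = DIM('a)"
    using dim_orthogonal_to_pair independent_normals[OF A \<open>H \<noteq> H'\<close>] by simp
  moreover have "?X \<in> intersection_subspaces \<A>"
    using A unfolding intersection_subspaces_def by (intro CollectI exI[of _ "{H, H'}"]) auto
  ultimately have "convex_wrt ?B (chamber_containing ?B c\<^sub>0) (J \<inter> ?B)"
    using J(1) by (simp add: two_closed_def)
  then obtain q where q: "\<nu> K \<bullet> q > 0" "\<forall>L\<in>J \<inter> ?B. \<nu> L \<bullet> q \<le> 0"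
    unfolding convex_wrt_localization_iff[OF assms(1,2) sub(1)] using K by blast
  have "K \<in> \<A>" "?X \<subseteq> K" using K by (auto simp: localization_def)
  then obtain s t where "s \<ge> 0" "t \<ge> 0" "\<nu> K = s *\<^sub>R \<nu> H + t *\<^sub>R \<nu> H'"
    using upper_walls_combination(2)[OF p \<open>H \<noteq> H'\<close> H H'] by blast
  moreover have "\<nu> H \<bullet> q \<le> 0" "\<nu> H' \<bullet> q \<le> 0" using q(2) J sub by auto
  ultimately have "\<nu> K \<bullet> q \<le> 0"
    by (auto simp: inner_add_left intro!: add_nonpos_nonpos mult_nonneg_nonpos)
  with q(1) show False by simp
qed

text \<open>The point sought is \<open>q - e *\<^sub>R p\<close> for small \<open>e > 0\<close>.
  Hyperplanes not containing \<open>X\<close> keep their sign at \<open>q\<close>, which is that at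
  \<open>p\<close>; on those containing \<open>X\<close> the point \<open>q\<close> vanishes and the
  sign at \<open>p\<close> is reversed.\<close>

lemma flip_across_subspace:
  assumes p: "generic p" and q: "q \<in> X"
    "\<And>K. K \<in> \<A> \<Longrightarrow> \<not> X \<subseteq> K \<Longrightarrow> (\<nu> K \<bullet> q) * (\<nu> K \<bullet> p) > 0"
    and disj: "pos p \<inter> localization \<A> X = {}"
  obtains d where "generic d" "pos d = pos p \<union> localization \<A> X"
proof -
  obtain e where e: "e > 0" "\<And>K. K \<in> \<A> \<Longrightarrow> \<nu> K \<bullet> q \<noteq> 0 \<Longrightarrow>
      (\<nu> K \<bullet> (q + e *\<^sub>R - p)) * (\<nu> K \<bullet> q) > 0"
    using small_perturbation_preserves_signs[OF fin, of \<nu> q "- p"] by metis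
  define d where "d = q + e *\<^sub>R - p"
  have 1: "(\<nu> K \<bullet> d) * (\<nu> K \<bullet> p) > 0" if "K \<in> \<A>" "\<not> X \<subseteq> K" for K
    using e(2)[OF that(1)] q(2)[OF that] unfolding d_def by (auto simp: zero_less_mult_iff)
  have 2: "\<nu> K \<bullet> d > 0" if "K \<in> \<A>" "X \<subseteq> K" for K
  proof -
    have "\<nu> K \<bullet> q = 0" using that q(1) mem_iff by blast
    moreover have "\<nu> K \<bullet> p < 0"
      using that disj p by (auto simp: localization_def pos_def generic_def not_less order_less_le)
    ultimately show ?thesis using e(1) by (simp add: d_def inner_diff_right mult_pos_neg)
  qed
  show thesis
  proof
    show "generic d" unfolding generic_def using 1 2 by force
    show "pos d = pos p \<union> localization \<A> X"
    proof (rule Set.set_eqI)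
      fix K show "K \<in> pos d \<longleftrightarrow> K \<in> pos p \<union> localization \<A> X"
        using 1[of K] 2[of K]
        by (cases "X \<subseteq> K") (auto simp: pos_def localization_def zero_less_mult_iff)
    qed
  qed
qed

text \<open>Adding all hyperplanes through \<open>H \<inter> H'\<close> to \<open>pos p\<close>
  yields a separation set, hence a 2-closed set, and every 2-closed set containing \<open>H\<close>,
  \<open>H'\<close> and \<open>pos p\<close> must include them.\<close>

lemma two_closure_two_upper_walls:
  assumes c0: "c\<^sub>0 \<in> chambers \<A>" "b \<in> c\<^sub>0" "bineighborly \<A> c\<^sub>0"
    and p: "generic p" and "H \<noteq> H'"
    and H: "wall_pt p H r" "H \<notin> pos p" and H': "wall_pt p H' r'" "H' \<notin> pos p"
  obtains d where "generic d" "pos d = two_closure \<A> c\<^sub>0 (insert H (insert H' (pos p)))"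
proof -
  let ?X = "H \<inter> H'" and ?K = "insert H (insert H' (pos p))"
  have A: "H \<in> \<A>" "H' \<in> \<A>" using H H' by (auto simp: wall_pt_def)
  obtain q where q: "q \<in> ?X" "\<And>K. K \<in> \<A> \<Longrightarrow> \<not> ?X \<subseteq> K \<Longrightarrow> (\<nu> K \<bullet> q) * (\<nu> K \<bullet> p) > 0"
    using upper_walls_incident[OF c0 p H H'] by metis
  have "pos p \<inter> localization \<A> ?X = {}"
    using upper_walls_combination(1)[OF p \<open>H \<noteq> H'\<close> H H'] by (auto simp: localization_def)
  then obtain d where d: "generic d" "pos d = pos p \<union> localization \<A> ?X"
    using flip_across_subspace[OF p q] by metis
  have sub: "?K \<subseteq> two_closure \<A> c\<^sub>0 ?K" unfolding two_closure_def by (rule hull_subset)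
  have "two_closed \<A> c\<^sub>0 (two_closure \<A> c\<^sub>0 ?K)"
    using A by (intro two_closed_two_closure) (auto simp: pos_def)
  then have "localization \<A> ?X \<subseteq> two_closure \<A> c\<^sub>0 ?K"
    using sub by (intro localization_subset_two_closed[OF c0(1,2) p \<open>H \<noteq> H'\<close> H H']) auto
  then have "pos d = two_closure \<A> c\<^sub>0 ?K"
    using sub d two_closed_pos[OF c0(1,2) d(1)] A
    by (intro equalityI two_closure_minimal) (auto simp: localization_def)
  with d(1) show thesis by (rule that)
qed

section \<open>Realizing the 2-closure by a chamber\<close>

lemma two_closure_Un_pos:
  assumes c0: "c\<^sub>0 \<in> chambers \<A>" "b \<in> c\<^sub>0" "bineighborly \<A> c\<^sub>0"
    and "generic p" "generic q"
  shows "two_closure \<A> c\<^sub>0 (pos p \<union> pos q) \<in> pos ` Collect generic"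
proof -
  \<comment> \<open>\<open>U C H\<close> says that \<open>H\<close> is an upper wall of the chamber
    with separation set \<open>C\<close>. Recording that \<open>insert H C\<close> is a separation
    set settles the degenerate case \<open>H = H'\<close> below.\<close>
  define U where "U C H \<longleftrightarrow> H \<notin> C \<and> insert H C \<in> pos ` Collect generic \<and>
      (\<exists>p r. generic p \<and> C = pos p \<and> wall_pt p H r)" for C H
  \<comment> \<open>Two uses of \<open>U C\<close> may supply different points for \<open>C\<close>,
    while both walls must be taken at one point. Being a wall point depends on \<open>p\<close> only
    through its signs.\<close>
  have wall_cong: "wall_pt p' H r" if "wall_pt p H r" "pos p = pos p'" "generic p" "generic p'"
    for p p' H r
    unfolding wall_pt_def
  proof (intro conjI ballI impI)
    fix K assume K: "K \<in> \<A>" "K \<noteq> H"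
    have "K \<in> pos p \<longleftrightarrow> K \<in> pos p'" using that(2) by simp
    then have "\<nu> K \<bullet> p > 0 \<longleftrightarrow> \<nu> K \<bullet> p' > 0" using K by (simp add: pos_def)
    moreover have "\<nu> K \<bullet> p' \<noteq> 0" using that(4) K by (simp add: generic_def)
    moreover have "(\<nu> K \<bullet> r) * (\<nu> K \<bullet> p) > 0" using that(1) K by (simp add: wall_pt_def)
    ultimately show "(\<nu> K \<bullet> r) * (\<nu> K \<bullet> p') > 0"
      unfolding zero_less_mult_iff by linarith
  qed (use that(1) in \<open>simp_all add: wall_pt_def\<close>)
  show ?thesis unfolding two_closure_def
  proof (rule closed_hull_of_Un_mem[where A = \<A> and U = U and C = "pos b"])
    show "finite \<A>" by (rule fin)
    show "C \<subseteq> \<A>" if "C \<in> pos ` Collect generic" for C using that by (auto simp: pos_def)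
    show "two_closed \<A> c\<^sub>0 C" if "C \<in> pos ` Collect generic" for C
      using that two_closed_pos[OF c0(1,2)] by auto
    show "\<exists>H. H \<in> X \<and> H \<notin> C \<and> U C H \<and> insert H C \<in> pos ` Collect generic"
      if asm: "C \<in> pos ` Collect generic" "X \<in> pos ` Collect generic" "C \<subset> X" for C X
    proof -
      obtain p q where pq: "generic p" "generic q" "C = pos p" "X = pos q" using asm by blast
      obtain H r p' where H: "H \<in> pos q" "H \<notin> pos p" "wall_pt p H r"
          "generic p'" "pos p' = insert H (pos p)"
        using upper_wall_exists[OF pq(1,2)] asm(3) pq(3,4) by metis
      then have ins: "insert H C \<in> pos ` Collect generic" using pq by (auto intro: rev_image_eqI)
      then have "U C H" unfolding U_def using H pq by blast
      then show ?thesis using ins H(1,2) unfolding pq(3,4) by (intro exI[of _ H] conjI)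
    qed
    show "two_closed \<A> c\<^sub>0 hull insert H (insert H' C) \<in> pos ` Collect generic"
      if asm: "C \<in> pos ` Collect generic" "U C H" "U C H'" for C H H'
    proof (cases "H = H'")
      case True
      then have "insert H (insert H' C) \<in> pos ` Collect generic"
        using asm(2) by (simp add: U_def)
      then obtain d where d: "generic d" "insert H (insert H' C) = pos d" by blast
      have "two_closed \<A> c\<^sub>0 hull pos d = pos d"
        using two_closed_pos[OF c0(1,2) d(1)] by (intro hull_unique) auto
      then show ?thesis using d by auto
    next
      case False
      obtain p r where p: "generic p" "C = pos p" "wall_pt p H r" "H \<notin> pos p"
        using asm(2) unfolding U_def by blast
      obtain p' r' where p': "generic p'" "C = pos p'" "wall_pt p' H' r'" "H' \<notin> pos p"
        using asm(3) p(2) unfolding U_def by blast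
      have w: "wall_pt p H' r'" using p'(3) _ p'(1) p(1) by (rule wall_cong) (use p(2) p'(2) in simp)
      obtain d where "generic d" "pos d = two_closure \<A> c\<^sub>0 (insert H (insert H' (pos p)))"
        using two_closure_two_upper_walls[OF c0 p(1) False p(3,4) w p'(4)] .
      then show ?thesis using p(2) unfolding two_closure_def by auto
    qed
    show "two_closed \<A> c\<^sub>0 (two_closed \<A> c\<^sub>0 hull K)" if "K \<subseteq> \<A>" for K
      using two_closed_two_closure[OF that] by (simp add: two_closure_def)
    \<comment> \<open>The base chamber is a common lower bound from which the induction
      starts.\<close>
    have "pos b = {}" using neg by (fastforce simp: pos_def)
    then show "pos b \<subseteq> pos p" "pos b \<subseteq> pos q" by auto
    show "pos b \<in> pos ` Collect generic" using generic_base by auto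
  qed (use assms in auto)
qed

end

text \<open>A normal can be replaced by its negative, and \<open>b\<close> lies on no hyperplane, so
  the required orientation exists.\<close>

lemma central_arrangement_based:
  assumes "central_arrangement \<A>" "b \<notin> \<Union>\<A>"
  obtains \<nu> where "based_arrangement \<A> \<nu> b"
proof -
  have "\<exists>a. a \<noteq> 0 \<and> H = {x. a \<bullet> x = 0} \<and> a \<bullet> b < 0" if H: "H \<in> \<A>" for H
  proof -
    obtain a where a: "a \<noteq> 0" "H = {x. a \<bullet> x = 0}"
      using hyperplane_eq_inner assms(1) H unfolding central_arrangement_def by metis
    then have "a \<bullet> b \<noteq> 0" using assms(2) H by blast
    then consider "a \<bullet> b < 0" | "(- a) \<bullet> b < 0" by force
    then show ?thesis
    proof cases
      case 2
      then show ?thesis using a by (intro exI[of _ "- a"]) auto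
    qed (use a in blast)
  qed
  then obtain \<nu> where "\<And>H. H \<in> \<A> \<Longrightarrow> \<nu> H \<noteq> 0 \<and> H = {x. \<nu> H \<bullet> x = 0} \<and> \<nu> H \<bullet> b < 0"
    by metis
  then have "based_arrangement \<A> \<nu> b"
    using assms(1) by unfold_locales (auto simp: central_arrangement_def)
  then show thesis by (rule that)
qed

theorem theorem5p1:
  fixes \<A> :: "(real ^ 'n) set set" and c\<^sub>0 x y :: "(real ^ 'n) set"
  assumes "central_arrangement \<A>"
    and "c\<^sub>0 \<in> chambers \<A>"
    and "bineighborly \<A> c\<^sub>0"
    and "x \<in> chambers \<A>" and "y \<in> chambers \<A>"
  shows "sep_set \<A> c\<^sub>0 (x \<squnion>\<^bsub>region_poset \<A> c\<^sub>0\<^esub> y)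
       = two_closure \<A> c\<^sub>0 (sep_set \<A> c\<^sub>0 x \<union> sep_set \<A> c\<^sub>0 y)"
proof -
  let ?S = "sep_set \<A> c\<^sub>0"
  obtain b where b: "b \<in> c\<^sub>0"
    using assms(2) in_components_nonempty unfolding chambers_def by blast
  then have "b \<notin> \<Union>\<A>" using assms(2) in_components_subset unfolding chambers_def by blast
  then obtain \<nu> where "based_arrangement \<A> \<nu> b"
    using central_arrangement_based[OF assms(1)] by blast
  then interpret based_arrangement \<A> \<nu> b .
  note S = sep_sets_eq[OF assms(2) b]
  obtain p q where pq: "generic p" "?S x = pos p" "generic q" "?S y = pos q"
    using S assms(4,5) by (smt (verit) imageE image_eqI mem_Collect_eq)
  have "two_closure \<A> c\<^sub>0 (?S x \<union> ?S y) \<in> ?S ` chambers \<A>"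
    unfolding S pq using two_closure_Un_pos[OF assms(2) b assms(3)] pq by simp
  then obtain z where z: "z \<in> chambers \<A>" "?S z = two_closure \<A> c\<^sub>0 (?S x \<union> ?S y)" by auto
  \<comment> \<open>\<open>z\<close> is above \<open>x\<close> and \<open>y\<close> because a hull
    contains its generators. It is below every upper bound \<open>w\<close> because the separation
    set of \<open>w\<close> is 2-closed.\<close>
  have "?S (x \<squnion>\<^bsub>region_poset \<A> c\<^sub>0\<^esub> y) = ?S z"
  proof (rule sep_set_join[OF z(1) assms(4,5)], rule iffI)
    fix w assume w: "w \<in> chambers \<A>"
    have "?S x \<union> ?S y \<subseteq> ?S z" unfolding z(2) two_closure_def by (rule hull_subset)
    then show "?S x \<subseteq> ?S w \<and> ?S y \<subseteq> ?S w" if "?S z \<subseteq> ?S w" using that by blast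
    have "?S w \<in> pos ` Collect generic" using S w by blast
    then have "two_closed \<A> c\<^sub>0 (?S w)" using two_closed_pos[OF assms(2) b] by auto
    then show "?S z \<subseteq> ?S w" if "?S x \<subseteq> ?S w \<and> ?S y \<subseteq> ?S w"
      unfolding z(2) using that by (intro two_closure_minimal) auto
  qed
  with z(2) show ?thesis by simp
qed

end
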